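(* Let $n\ge 2$, let $v=(v_1,\dots,v_n)^T,\ u=(u_1,\dots,u_n)^T\in\mathbb{C}^n$, and let $H=vv^*+uu^*$. Then $$\det(\mathscr{C}_1(H))=\frac{\operatorname{per}(H)}{n}\prod_{k=1}^{n-1}n\,(k-1)!\,(n-1-k)!\cdot\prod_{1\le i<j\le n}|v_iu_j-v_ju_i|^2 .$$
   Context: For an $n\times n$ complex matrix $A=(a_{ij})$, $\operatorname{per}(A)=\sum_{\sigma\in S_n}\prod_{i=1}^n a_{i\sigma(i)}$. $\mathscr{C}_1(A)$ is the $n\times n$ matrix whose $(i,j)$ entry is $a_{ij}\cdot\operatorname{per}(A(i|j))$, where $A(i|j)$ is the $(n-1)\times(n-1)$ matrix obtained from $A$ by deleting row $i$ and column $j$ (the permanent of the empty matrix is $1$). *)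

theory Defs
  imports "Jordan_Normal_Form.Determinant" "Jordan_Normal_Form.Schur_Decomposition"
begin

text \<open>Rows and columns are indexed from 0, as everywhere in \<open>Jordan_Normal_Form\<close>.
  The definitions of \<open>per\<close> and \<open>C1\<close> are meaningful for square matrices only.\<close>

definition per :: "'a :: comm_semiring_1 mat \<Rightarrow> 'a" where
  "per A = (\<Sum>\<sigma> | \<sigma> permutes {0..<dim_row A}. \<Prod>i = 0..<dim_row A. A $$ (i, \<sigma> i))"

definition C1 :: "'a :: comm_semiring_1 mat \<Rightarrow> 'a mat" where
  "C1 A = mat (dim_row A) (dim_col A) (\<lambda>(i, j). A $$ (i, j) * per (mat_delete A i j))"

definition col_mat :: "'a vec \<Rightarrow> 'a mat" where
  "col_mat v = mat_of_cols (dim_vec v) [v]"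

lemma per_empty: "dim_row A = 0 \<Longrightarrow> per A = 1"
  by (simp add: per_def)

lemma col_mat_times_adjoint:
  fixes v :: "complex vec"
  assumes "v \<in> carrier_vec n"
  shows "col_mat v * mat_adjoint (col_mat v) = mat n n (\<lambda>(i, j). v $ i * cnj (v $ j))"
  using assms
  by (intro eq_matI)
    (auto simp: col_mat_def mat_adjoint_def mat_of_cols_def mat_of_rows_def
      scalar_prod_def cols_def conjugate_complex_def)

end

theory Submission
  imports Defs
begin

text \<open>
  Let \<open>P(x) = \<Prod>\<^sub>l (u\<^sub>l + v\<^sub>l x)\<close> have coefficients \<open>e\<^sub>k\<close>, let \<open>P\<^sub>i\<close> be \<open>P\<close> without its \<open>i\<close>-th factor, and
  let \<open>w\<^sub>k\<close> be the vector whose \<open>i\<close>-th entry is \<open>v\<^sub>i\<close> times the coefficient of \<open>x\<close>-degree \<open>k - 1\<close> in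
  \<open>P\<^sub>i\<close>. Expanding the permanent over subsets gives \<open>per H = \<Sum>\<^sub>k k! (n - k)! |e\<^sub>k|\<^sup>2\<close>. The same expansion
  for the minors, together with \<open>P = (u\<^sub>i + v\<^sub>i x) P\<^sub>i\<close>, writes \<open>C1 H\<close> in terms of the \<open>w\<^sub>k\<close> and
  \<open>e\<^sub>k 1 - w\<^sub>k\<close>; completing the square for each \<open>k\<close> yields
  \<open>C1 H = per H / n 1 1\<^sup>* + \<Sum>\<^sub>k n (k - 1)! (n - 1 - k)! z\<^sub>k z\<^sub>k\<^sup>*\<close> with \<open>z\<^sub>k = w\<^sub>k - (k e\<^sub>k / n) 1\<close> and
  \<open>1 \<le> k < n\<close>. Hence \<open>det (C1 H)\<close> is the product of these \<open>n\<close> weights and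
  \<open>|det [1, w\<^sub>1, \<dots>, w\<^sub>n\<^sub>-\<^sub>1]|\<^sup>2\<close>. Subtracting the first row reduces the last determinant to that of the
  coefficients of the polynomials \<open>P\<^sub>i\<close>, which is \<open>\<Prod>\<^sub>i\<^sub><\<^sub>j (v\<^sub>i u\<^sub>j - v\<^sub>j u\<^sub>i)\<close>.
  The adjoint plays no role: everything holds for \<open>H\<^sub>i\<^sub>j = v\<^sub>i a\<^sub>j + u\<^sub>i b\<^sub>j\<close>.
\<close>

section \<open>Permutations with prescribed image of a subset\<close>

lemma permutes_image_transitive:
  assumes "finite A" "S \<subseteq> A" "T \<subseteq> A" "card S = card T"
  obtains p where "p permutes A" "p ` S = T"
proof -
  have fin: "finite S" "finite T" "finite (A - S)" "finite (A - T)"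
    using assms finite_subset by auto
  have "card (A - S) = card (A - T)"
    using assms fin by (simp add: card_Diff_subset)
  then obtain g where g: "bij_betw g (A - S) (A - T)"
    using fin finite_same_card_bij by blast
  obtain f where f: "bij_betw f S T"
    using fin assms finite_same_card_bij by blast
  define p where "p x = (if x \<in> S then f x else if x \<in> A then g x else x)" for x
  have "bij_betw p S T"
    using f by (rule bij_betw_cong[THEN iffD1, rotated]) (auto simp: p_def)
  moreover have "bij_betw p (A - S) (A - T)"
    using g by (rule bij_betw_cong[THEN iffD1, rotated]) (auto simp: p_def)
  ultimately have "bij_betw p (S \<union> (A - S)) (T \<union> (A - T))"
    by (rule bij_betw_combine) auto
  moreover have "S \<union> (A - S) = A" "T \<union> (A - T) = A"
    using assms by auto
  ultimately have "p permutes A"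
    using assms(2) by (intro bij_imp_permutes) (auto simp: p_def)
  moreover have "p ` S = T"
    using \<open>bij_betw p S T\<close> by (rule bij_betw_imp_surj_on)
  ultimately show ?thesis by (rule that)
qed

text \<open>Left composition with a permutation carrying \<open>X\<close> to \<open>Y\<close>
  injects the permutations with image \<open>X\<close> into those with image \<open>Y\<close>. By
  symmetry all fibres have equal size, and \<open>card A choose card S\<close> of them share the
  \<open>fact (card A)\<close> permutations.\<close>

lemma card_permutes_image_eq:
  assumes "finite A" "S \<subseteq> A" "T \<subseteq> A" "card S = card T"
  shows "card {p. p permutes A \<and> p ` S = T} = fact (card S) * fact (card A - card S)"
proof -
  define N where "N T = card {p. p permutes A \<and> p ` S = T}" for T
  have N_le: "N X \<le> N Y" if XY: "X \<subseteq> A" "Y \<subseteq> A" "card X = card Y" for X Y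
  proof -
    obtain q where q: "q permutes A" "q ` X = Y"
      using permutes_image_transitive[OF assms(1) XY] by blast
    show ?thesis unfolding N_def
    proof (rule card_inj_on_le)
      show "inj_on ((\<circ>) q) {p. p permutes A \<and> p ` S = X}"
        using permutes_inj[OF q(1)] by (auto intro!: inj_onI simp: fun.inj_map_strong fun_eq_iff inj_def)
      show "(\<circ>) q ` {p. p permutes A \<and> p ` S = X} \<subseteq> {p. p permutes A \<and> p ` S = Y}"
        using q by (auto simp: permutes_compose image_comp[symmetric])
      show "finite {p. p permutes A \<and> p ` S = Y}"
        using finite_permutations[OF assms(1)] by (rule rev_finite_subset) auto
    qed
  qed
  define K where "K = {X. X \<subseteq> A \<and> card X = card S}"
  have "fact (card A) = card {p. p permutes A}"
    using assms(1) by (simp add: card_permutations)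
  also have "\<dots> = (\<Sum>X\<in>K. card {p \<in> {p. p permutes A}. p ` S = X})"
    unfolding card_eq_sum
  proof (rule sum.group[symmetric])
    show "(\<lambda>p. p ` S) ` {p. p permutes A} \<subseteq> K"
      using assms(2) by (auto simp: K_def permutes_in_image intro!: card_image
          dest: permutes_inj intro: inj_on_subset)
  qed (use assms(1) in \<open>auto simp: finite_permutations K_def\<close>)
  also have "\<dots> = (\<Sum>X\<in>K. N X)" by (simp add: N_def)
  also have "\<dots> = (\<Sum>X\<in>K. N T)"
    using assms N_le by (intro sum.cong) (auto simp: K_def intro!: antisym)
  also have "\<dots> = (card A choose card S) * N T"
    using n_subsets[OF assms(1), of "card S"] by (simp add: K_def)
  finally have "fact (card A) = (card A choose card S) * N T" .
  moreover have le: "card S \<le> card A" using assms by (simp add: card_mono)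
  have "fact (card S) * fact (card A - card S) * (card A choose card S) = (fact (card A) :: nat)"
    using binomial_fact_lemma[OF le] .
  ultimately have "(card A choose card S) * N T
      = (card A choose card S) * (fact (card S) * fact (card A - card S))"
    by (auto simp: mult.commute)
  then show ?thesis using le by (auto simp: N_def)
qed

lemma sum_permutes_image:
  fixes F :: "'b set \<Rightarrow> 'a :: {comm_semiring_1, semiring_char_0}"
  assumes "finite A" "S \<subseteq> A"
  shows "(\<Sum>p | p permutes A. F (p ` S))
    = fact (card S) * fact (card A - card S) * (\<Sum>T | T \<subseteq> A \<and> card T = card S. F T)"
proof -
  define K where "K = {X. X \<subseteq> A \<and> card X = card S}"
  have "(\<Sum>p | p permutes A. F (p ` S))
      = (\<Sum>X\<in>K. \<Sum>p \<in> {p \<in> {p. p permutes A}. p ` S = X}. F (p ` S))"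
  proof (rule sum.group[symmetric])
    show "(\<lambda>p. p ` S) ` {p. p permutes A} \<subseteq> K"
      using assms(2) by (auto simp: K_def permutes_in_image intro!: card_image
          dest: permutes_inj intro: inj_on_subset)
  qed (use assms(1) in \<open>auto simp: finite_permutations K_def\<close>)
  also have "\<dots> = (\<Sum>X\<in>K. of_nat (card {p. p permutes A \<and> p ` S = X}) * F X)"
    by (intro sum.cong) auto
  also have "\<dots> = (\<Sum>X\<in>K. fact (card S) * fact (card A - card S) * F X)"
    using assms by (intro sum.cong) (auto simp: K_def card_permutes_image_eq)
  finally show ?thesis by (simp add: K_def sum_distrib_left)
qed

section \<open>Products of linear forms and permanents of rank-two matrices\<close>

text \<open>Slopes come first, constant terms second. No factor is normalised, so slopes may vanish
  and the degree may be smaller than \<open>card A\<close>.\<close>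

definition lin_prod :: "('b \<Rightarrow> 'a) \<Rightarrow> ('b \<Rightarrow> 'a) \<Rightarrow> 'b set \<Rightarrow> 'a :: comm_semiring_1 poly" where
  "lin_prod v u A = (\<Prod>i\<in>A. [:u i, v i:])"

lemma prod_monom: "(\<Prod>i\<in>A. monom (f i) (d i)) = monom (prod f A) (sum d A)"
  by (induction A rule: infinite_finite_induct) (auto simp: mult_monom)

lemma coeff_lin_prod:
  assumes "finite A"
  shows "coeff (lin_prod v u A) k
    = (\<Sum>S | S \<subseteq> A \<and> card S = k. prod v S * prod u (A - S))"
proof -
  \<comment> \<open>With each factor a sum of two monomials, \<open>prod_add\<close> expands over
    the set \<open>S\<close> of factors that contribute their linear term.\<close>
  have "lin_prod v u A = (\<Prod>i\<in>A. monom (v i) 1 + monom (u i) 0)"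
    by (simp add: lin_prod_def monom_altdef)
  also have "\<dots> = (\<Sum>S\<in>Pow A. monom (prod v S * prod u (A - S)) (card S))"
    using assms by (simp add: prod_add prod_monom mult_monom)
  finally have "coeff (lin_prod v u A) k
      = (\<Sum>S\<in>Pow A. if card S = k then prod v S * prod u (A - S) else 0)"
    by (simp add: coeff_sum)
  also have "\<dots> = (\<Sum>S\<in>{S \<in> Pow A. card S = k}. prod v S * prod u (A - S))"
    using assms by (simp add: sum.inter_filter del: Pow_iff)
  finally show ?thesis by simp
qed

text \<open>Expand each product over the set \<open>S\<close> of rows that pick
  \<open>v i * a (p i)\<close>. The part in \<open>a\<close> and \<open>b\<close> depends on
  \<open>p\<close> only through the image of \<open>S\<close>, so summing over \<open>p\<close>
  turns it into a coefficient with a factorial weight.\<close>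

lemma per_rank_two:
  fixes v u a b :: "nat \<Rightarrow> 'a :: {comm_semiring_1, semiring_char_0}"
  shows "per (mat n n (\<lambda>(i, j). v i * a j + u i * b j))
    = (\<Sum>k\<le>n. fact k * fact (n - k)
        * coeff (lin_prod v u {0..<n}) k * coeff (lin_prod a b {0..<n}) k)"
proof -
  let ?N = "{0..<n}"
  have expand: "(\<Prod>i\<in>?N. v i * a (p i) + u i * b (p i))
      = (\<Sum>S\<in>Pow ?N. prod v S * prod u (?N - S) * (prod a (p ` S) * prod b (?N - p ` S)))"
    if p: "p permutes ?N" for p
  proof -
    have inj: "inj_on p X" for X using permutes_inj[OF p] by (rule inj_on_subset) auto
    have "?N - p ` S = p ` (?N - S)" for S
      using permutes_image[OF p] inj[of UNIV] by (simp add: image_set_diff)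
    then show ?thesis
      by (simp add: prod_add prod.distrib mult_ac prod.reindex[OF inj, unfolded o_def])
  qed
  have "per (mat n n (\<lambda>(i, j). v i * a j + u i * b j))
      = (\<Sum>p | p permutes ?N. \<Prod>i\<in>?N. v i * a (p i) + u i * b (p i))"
    unfolding per_def by (auto intro!: sum.cong prod.cong simp: permutes_in_image)
  also have "\<dots> = (\<Sum>p | p permutes ?N. \<Sum>S\<in>Pow ?N.
      prod v S * prod u (?N - S) * (prod a (p ` S) * prod b (?N - p ` S)))"
    by (auto intro!: sum.cong simp: expand)
  also have "\<dots> = (\<Sum>S\<in>Pow ?N. prod v S * prod u (?N - S)
      * (\<Sum>p | p permutes ?N. prod a (p ` S) * prod b (?N - p ` S)))"
    by (subst sum.swap) (simp add: sum_distrib_left)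
  also have "\<dots> = (\<Sum>S\<in>Pow ?N. prod v S * prod u (?N - S)
      * (fact (card S) * fact (n - card S) * coeff (lin_prod a b ?N) (card S)))"
    by (intro sum.cong refl arg_cong2[where f = "(*)"])
      (auto simp: sum_permutes_image[where F = "\<lambda>T. prod a T * prod b (_ - T)"] coeff_lin_prod)
  also have "\<dots> = (\<Sum>k\<le>n. \<Sum>S \<in> {S \<in> Pow ?N. card S = k}. prod v S * prod u (?N - S)
      * (fact (card S) * fact (n - card S) * coeff (lin_prod a b ?N) (card S)))"
    by (rule sum.group[symmetric]) (auto dest: card_mono[rotated])
  also have "\<dots> = (\<Sum>k\<le>n. fact k * fact (n - k)
        * coeff (lin_prod v u {0..<n}) k * coeff (lin_prod a b {0..<n}) k)"
    by (intro sum.cong refl)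
      (simp add: coeff_lin_prod[of ?N v] sum_distrib_left sum_distrib_right mult_ac)
  finally show ?thesis .
qed

lemma lin_prod_remove:
  assumes "finite A" "i \<in> A"
  shows "lin_prod v u A = [:u i, v i:] * lin_prod v u (A - {i})"
  unfolding lin_prod_def using assms by (rule prod.remove)

lemma lin_prod_reindex:
  assumes "inj_on f A"
  shows "lin_prod (v \<circ> f) (u \<circ> f) A = lin_prod v u (f ` A)"
  using assms by (simp add: lin_prod_def prod.reindex)

lemma coeff_lin_prod_eq_0:
  assumes "finite A" "card A < k"
  shows "coeff (lin_prod v u A) k = 0"
proof -
  have none: "{S. S \<subseteq> A \<and> card S = k} = {}"
    using assms(2) by (auto dest: card_mono[OF assms(1)])
  show ?thesis unfolding coeff_lin_prod[OF assms(1)] none by simp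
qed

text \<open>This replaces evaluation at \<open>x / y\<close> and stays meaningful for
  \<open>y = 0\<close>; it serves to evaluate at the root of a linear factor whose slope may
  vanish.\<close>

lemma sum_coeff_lin_prod_homogeneous:
  assumes "finite A"
  shows "(\<Sum>k\<le>card A. coeff (lin_prod v u A) k * x ^ k * y ^ (card A - k))
    = (\<Prod>i\<in>A. v i * x + u i * y)"
proof -
  have "(\<Prod>i\<in>A. v i * x + u i * y)
      = (\<Sum>S\<in>Pow A. prod v S * prod u (A - S) * x ^ card S * y ^ (card A - card S))"
    using assms by (auto simp: prod_add prod.distrib card_Diff_subset finite_subset mult_ac intro!: sum.cong)
  also have "\<dots> = (\<Sum>k\<le>card A. \<Sum>S \<in> {S \<in> Pow A. card S = k}.
      prod v S * prod u (A - S) * x ^ card S * y ^ (card A - card S))"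
    using assms by (intro sum.group[symmetric]) (auto intro: card_mono)
  finally show ?thesis
    by (simp add: coeff_lin_prod[OF assms] sum_distrib_right)
qed

section \<open>Splitting off index 0, and elementary operations on determinants\<close>

lemma prod_less_pairs_Suc:
  "(\<Prod>(i, j) \<in> {(i, j). i < j \<and> j < Suc m}. f i j)
    = (\<Prod>j = 0..<m. f 0 (Suc j)) * (\<Prod>(i, j) \<in> {(i, j). i < j \<and> j < m}. f (Suc i) (Suc j))"
proof -
  let ?P = "{(i, j). i < j \<and> j < m}"
  have split: "{(i, j). i < j \<and> j < Suc m}
      = (\<lambda>j. (0, Suc j)) ` {0..<m} \<union> (\<lambda>(i, j). (Suc i, Suc j)) ` ?P"
  proof (intro equalityI subsetI)
    fix x assume "x \<in> {(i, j). i < j \<and> j < Suc m}"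
    then obtain i j where x: "x = (i, Suc j)" "i < Suc j" "j < m"
      by (cases x; cases "snd x") auto
    then show "x \<in> (\<lambda>j. (0, Suc j)) ` {0..<m} \<union> (\<lambda>(i, j). (Suc i, Suc j)) ` ?P"
      by (cases i) (auto simp: image_iff)
  qed auto
  have fin: "finite ?P" by (rule finite_subset[of _ "{0..<m} \<times> {0..<m}"]) auto
  show ?thesis unfolding split
    by (subst prod.union_disjoint)
      (use fin in \<open>auto simp: prod.reindex inj_on_def case_prod_unfold\<close>)
qed

lemma det_scale_cols:
  "det (mat n n (\<lambda>(i, j). d j * M i j)) = (\<Prod>j = 0..<n. d j) * det (mat n n (\<lambda>(i, j). M i j))"
    for d :: "nat \<Rightarrow> 'a :: comm_ring_1"
proof -
  have 1: "(\<Prod>i = 0..<n. mat n n (\<lambda>(i, j). d j * M i j) $$ (i, p i))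
      = (\<Prod>j = 0..<n. d j) * (\<Prod>i = 0..<n. mat n n (\<lambda>(i, j). M i j) $$ (i, p i))"
    if "p permutes {0..<n}" for p
  proof -
    have "(\<Prod>i = 0..<n. mat n n (\<lambda>(i, j). d j * M i j) $$ (i, p i))
        = (\<Prod>i = 0..<n. d (p i)) * (\<Prod>i = 0..<n. mat n n (\<lambda>(i, j). M i j) $$ (i, p i))"
      unfolding prod.distrib[symmetric] using that
      by (auto intro!: prod.cong simp: permutes_in_image)
    also have "(\<Prod>i = 0..<n. d (p i)) = (\<Prod>j = 0..<n. d j)"
      using prod.permute[OF that, of d] by (simp add: o_def)
    finally show ?thesis .
  qed
  show ?thesis
    unfolding det_def'[OF mat_carrier] sum_distrib_left
    by (intro sum.cong refl, subst 1) (auto simp only: mem_Collect_eq mult_ac)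
qed

lemma det_scale_rows:
  "det (mat n n (\<lambda>(i, j). d i * M i j)) = (\<Prod>i = 0..<n. d i) * det (mat n n (\<lambda>(i, j). M i j))"
    for d :: "nat \<Rightarrow> 'a :: comm_ring_1"
proof -
  have "det (mat n n (\<lambda>(i, j). d i * M i j)) = det (mat n n (\<lambda>(i, j). d j * M j i))"
    by (subst det_transpose[of _ n, symmetric]) (auto intro!: arg_cong[of _ _ det] eq_matI)
  also have "\<dots> = (\<Prod>i = 0..<n. d i) * det (mat n n (\<lambda>(i, j). M j i))"
    by (rule det_scale_cols)
  also have "det (mat n n (\<lambda>(i, j). M j i)) = det (mat n n (\<lambda>(i, j). M i j))"
    by (subst det_transpose[of _ n, symmetric]) (auto intro!: arg_cong[of _ _ det] eq_matI)
  finally show ?thesis .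
qed

text \<open>The matrix is the product of \<open>M\<close>, the diagonal matrix of \<open>d\<close>,
  and the transpose of \<open>N\<close>.\<close>

lemma det_mat_sum_rank_one:
  fixes d :: "nat \<Rightarrow> 'a :: comm_ring_1"
  shows "det (mat n n (\<lambda>(i, j). \<Sum>k = 0..<n. d k * M i k * N j k))
    = (\<Prod>k = 0..<n. d k) * det (mat n n (\<lambda>(i, k). M i k)) * det (mat n n (\<lambda>(i, k). N i k))"
proof -
  have "mat n n (\<lambda>(i, j). \<Sum>k = 0..<n. d k * M i k * N j k)
      = mat n n (\<lambda>(i, k). d k * M i k) * (mat n n (\<lambda>(i, k). N i k))\<^sup>T"
    by (rule eq_matI) (auto simp: scalar_prod_def)
  then show ?thesis
    by (simp add: det_mult[of _ n] det_scale_cols det_transpose[of _ n])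
qed

lemma det_upper_triangular_const_diag:
  fixes A :: "'a :: comm_ring_1 mat"
  assumes "A \<in> carrier_mat n n" "\<And>i. i < n \<Longrightarrow> A $$ (i, i) = c"
    and "\<And>i j. j < i \<Longrightarrow> i < n \<Longrightarrow> A $$ (i, j) = 0"
  shows "det A = c ^ n"
proof -
  have "det A = (\<Prod>i = 0..<n. A $$ (i, i))"
    using assms by (subst det_upper_triangular[of _ n]) (auto simp: prod_list_diag_prod upper_triangular_def)
  then show ?thesis using assms(2) by simp
qed

lemma det_first_col_unit:
  fixes A :: "'a :: comm_ring_1 mat"
  assumes A: "A \<in> carrier_mat (Suc m) (Suc m)"
    and "A $$ (0, 0) = 1" "\<And>i. i < m \<Longrightarrow> A $$ (Suc i, 0) = 0"
  shows "det A = det (mat m m (\<lambda>(i, j). A $$ (Suc i, Suc j)))"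
proof -
  have "det A = (\<Sum>i<Suc m. A $$ (i, 0) * cofactor A i 0)"
    by (rule laplace_expansion_column[OF A]) simp
  also have "\<dots> = cofactor A 0 0"
    using assms by (simp add: sum.lessThan_Suc_shift del: sum.lessThan_Suc)
  also have "\<dots> = det (mat_delete A 0 0)" by (simp add: cofactor_def)
  also have "mat_delete A 0 0 = mat m m (\<lambda>(i, j). A $$ (Suc i, Suc j))"
    using A by (intro eq_matI) (auto simp: mat_delete_def)
  finally show ?thesis .
qed

text \<open>The shift \<open>c k\<close> does not depend on the row, so it is a multiple of the
  column of ones. This removes the centring terms that completing the square introduces.\<close>

lemma det_subtract_multiples_of_first_col:
  fixes W :: "nat \<Rightarrow> nat \<Rightarrow> 'a :: comm_ring_1"
  shows "det (mat n n (\<lambda>(i, k). if k = 0 then 1 else W i k - c k))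
    = det (mat n n (\<lambda>(i, k). if k = 0 then 1 else W i k))"
proof -
  define U where "U = mat n n (\<lambda>(i, k). if i = k then 1 else if i = 0 then - c k else 0)"
  have "mat n n (\<lambda>(i, k). if k = 0 then 1 else W i k - c k)
      = mat n n (\<lambda>(i, k). if k = 0 then 1 else W i k) * U"
  proof (rule eq_matI, goal_cases)
    case (1 i k)
    then have "0 < n" "k < n" by (auto simp: U_def)
    have "(\<Sum>l = 0..<n. (if l = 0 then 1 else W i l)
          * (if l = k then 1 else if l = 0 then - c k else 0))
        = (\<Sum>l = 0..<n. (if l = k then (if l = 0 then 1 else W i l) else 0)
          + (if l = 0 then (if k = 0 then 0 else - c k) else 0))"
      by (rule sum.cong) auto
    also have "\<dots> = (if k = 0 then 1 else W i k - c k)"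
      using \<open>0 < n\<close> \<open>k < n\<close> by (simp add: sum.distrib)
    finally show ?case using 1 by (simp add: U_def scalar_prod_def)
  qed (auto simp: U_def)
  moreover have "det U = 1"
    using det_upper_triangular_const_diag[of U n 1] by (simp add: U_def)
  ultimately show ?thesis
    by (simp add: det_mult[of _ n] U_def)
qed

lemma det_subtract_first_row:
  fixes W :: "nat \<Rightarrow> nat \<Rightarrow> 'a :: comm_ring_1"
  shows "det (mat (Suc m) (Suc m) (\<lambda>(i, k). if k = 0 then 1 else W i (k - 1)))
    = det (mat m m (\<lambda>(i, k). W (Suc i) k - W 0 k))"
proof -
  define V where "V i k = (if k = 0 then 1 else W i (k - 1))" for i k
  \<comment> \<open>\<open>L\<close> adds row 0 to every other row and so undoes the subtraction
    carried out in \<open>X\<close>.\<close>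
  define L where "L = mat (Suc m) (Suc m) (\<lambda>(i, j). if i = j \<or> j = 0 then 1 else 0 :: 'a)"
  define X where "X = mat (Suc m) (Suc m) (\<lambda>(i, k). if i = 0 then V 0 k else V i k - V 0 k)"
  have "mat (Suc m) (Suc m) (\<lambda>(i, k). V i k) = L * X"
  proof (rule eq_matI, goal_cases)
    case (1 i k)
    then have "i < Suc m" "k < Suc m" by (auto simp: L_def X_def)
    have "(\<Sum>l = 0..<Suc m. (if i = l \<or> l = 0 then 1 else 0)
          * (if l = 0 then V 0 k else V l k - V 0 k))
        = (\<Sum>l = 0..<Suc m. (if l = i then V i k - V 0 k else 0) + (if l = 0 then V 0 k else 0))"
      by (rule sum.cong) auto
    also have "\<dots> = V i k"
      using \<open>i < Suc m\<close> by (simp add: sum.distrib del: sum.op_ivl_Suc)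
    finally show ?case using \<open>i < Suc m\<close> \<open>k < Suc m\<close>
      by (simp add: L_def X_def scalar_prod_def del: sum.op_ivl_Suc)
  qed (auto simp: L_def X_def)
  moreover have "det L = 1"
    by (subst det_lower_triangular[of "Suc m"])
      (auto simp: L_def prod_list_diag_prod simp del: prod.op_ivl_Suc)
  ultimately have "det (mat (Suc m) (Suc m) (\<lambda>(i, k). V i k)) = det X"
    by (simp add: det_mult[of _ "Suc m"] L_def X_def)
  also have "\<dots> = det (mat m m (\<lambda>(i, k). X $$ (Suc i, Suc k)))"
    by (rule det_first_col_unit) (auto simp: X_def V_def)
  also have "mat m m (\<lambda>(i, k). X $$ (Suc i, Suc k)) = mat m m (\<lambda>(i, k). W (Suc i) k - W 0 k)"
    by (rule eq_matI) (auto simp: X_def V_def)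
  finally show ?thesis by (simp add: V_def)
qed

section \<open>Determinants of coefficients of products with one factor removed\<close>

text \<open>The rows below the first are the shifts of the linear polynomial with constant term
  \<open>y\<close> and slope \<open>x\<close>. The determinant is thus its resultant with the
  polynomial of coefficients \<open>c\<close>: the homogenised value of the latter at the root
  \<open>- y / x\<close>.\<close>

lemma det_linear_sylvester:
  fixes x y :: "'a :: comm_ring_1"
  shows "det (mat (Suc m) (Suc m) (\<lambda>(i, j).
      if i = 0 then c j else if j = i then x else if Suc j = i then y else 0))
    = (\<Sum>k\<le>m. c k * (- y) ^ k * x ^ (m - k))" (is "det (?D m) = _")
proof (induction m)
  case 0
  show ?case by (simp add: det_single)
next
  case (Suc m)
  let ?A = "?D (Suc m)"
  have "det ?A = (\<Sum>i<Suc (Suc m). ?A $$ (i, Suc m) * cofactor ?A i (Suc m))"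
    by (rule laplace_expansion_column) auto
  also have "\<dots> = (\<Sum>i\<in>{0, Suc m}. ?A $$ (i, Suc m) * cofactor ?A i (Suc m))"
    by (rule sum.mono_neutral_right) auto
  also have "\<dots> = c (Suc m) * cofactor ?A 0 (Suc m) + x * cofactor ?A (Suc m) (Suc m)"
    by simp
  \<comment> \<open>Without row 0 and the last column, \<open>y\<close> moves onto the diagonal and
    \<open>x\<close> lies just above it.\<close>
  also have "cofactor ?A 0 (Suc m) = (- 1) ^ Suc m * y ^ Suc m"
    unfolding cofactor_def
    by (subst det_upper_triangular_const_diag[of _ "Suc m" y]) (auto simp: mat_delete_def)
  also have "mat_delete ?A (Suc m) (Suc m) = ?D m"
    by (rule eq_matI) (auto simp: mat_delete_def)
  then have "cofactor ?A (Suc m) (Suc m) = (\<Sum>k\<le>m. c k * (- y) ^ k * x ^ (m - k))"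
    by (simp add: cofactor_def Suc.IH del: sum.atMost_Suc)
  finally show ?case
    by (simp add: sum_distrib_left power_minus[of y] Suc_diff_le mult_ac add.commute)
qed

text \<open>Induction removes index 0. The linear factor of index 0 divides every row polynomial but
  the first, and its resultant with the first yields the pairs \<open>(0, j)\<close>. The quotients
  form the same matrix for the shifted families, hence the generalisation over \<open>v\<close> and
  \<open>u\<close>.\<close>

lemma det_coeff_lin_prod_delete:
  fixes v u :: "nat \<Rightarrow> 'a :: comm_ring_1"
  shows "det (mat n n (\<lambda>(i, k). coeff (lin_prod v u ({0..<n} - {i})) k))
    = (\<Prod>(i, j) \<in> {(i, j). i < j \<and> j < n}. v i * u j - v j * u i)"
proof (induction n arbitrary: v u)
  case 0
  show ?case by simp
next
  case (Suc m)
  let ?v = "v \<circ> Suc" and ?u = "u \<circ> Suc"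
  define c where "c = coeff (lin_prod ?v ?u {0..<m})"
  define b where "b i = lin_prod ?v ?u ({0..<m} - {i})" for i
  define B where "B = mat (Suc m) (Suc m) (\<lambda>(i, k). coeff (lin_prod v u ({0..<Suc m} - {i})) k)"
  define C where "C = mat (Suc m) (Suc m) (\<lambda>(i, j).
    if i = 0 \<or> j = 0 then if i = j then 1 else 0 else coeff (b (i - 1)) (j - 1))"
  define D where "D = mat (Suc m) (Suc m) (\<lambda>(i, j).
    if i = 0 then c j else if j = i then v 0 else if Suc j = i then u 0 else 0)"
  have row_0: "lin_prod v u ({0..<Suc m} - {0}) = lin_prod ?v ?u {0..<m}"
    by (subst lin_prod_reindex) (auto intro!: arg_cong[of _ _ "lin_prod v u"] simp: image_Suc_atLeastLessThan)
  have row_Suc: "lin_prod v u ({0..<Suc m} - {Suc i}) = [:u 0, v 0:] * b i" if "i < m" for i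
  proof -
    have "{0..<Suc m} - {Suc i} - {0} = Suc ` ({0..<m} - {i})"
      by (auto simp: image_set_diff image_Suc_atLeastLessThan)
    then show ?thesis unfolding b_def
      by (subst lin_prod_remove[of _ 0]) (auto simp: lin_prod_reindex)
  qed
  \<comment> \<open>In the last column \<open>k = m\<close> the sum over \<open>j < m\<close> below
    has no term \<open>j = k\<close>; it is right because that coefficient is zero.\<close>
  have b_top: "coeff (b i) m = 0" if "i < m" for i
    unfolding b_def using that by (intro coeff_lin_prod_eq_0) auto
  \<comment> \<open>All rows but the first are multiples of \<open>u\<^sub>0 + v\<^sub>0 x\<close>, so \<open>B\<close> is block diagonal times
    a Sylvester matrix of \<open>u\<^sub>0 + v\<^sub>0 x\<close> and the first row.\<close>
  have "B = C * D"
  proof (rule eq_matI, goal_cases)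
    case (1 i k)
    then have ik: "i < Suc m" "k < Suc m" by (auto simp: C_def D_def)
    have CD: "(C * D) $$ (i, k) = C $$ (i, 0) * c k + (\<Sum>j = 0..<m. C $$ (i, Suc j) * D $$ (Suc j, k))"
      using ik by (simp add: C_def D_def scalar_prod_def sum.atLeast0_lessThan_Suc_shift
          del: sum.op_ivl_Suc)
    show ?case
    proof (cases i)
      case 0
      then show ?thesis using ik unfolding CD by (simp add: B_def C_def row_0 c_def)
    next
      case (Suc r)
      then have r: "r < m" using ik by simp
      have "(\<Sum>j = 0..<m. C $$ (i, Suc j) * D $$ (Suc j, k))
          = (\<Sum>j = 0..<m. (if Suc j = k then coeff (b r) j * v 0 else 0)
              + (if j = k then coeff (b r) j * u 0 else 0))"
        using ik Suc by (intro sum.cong) (auto simp: C_def D_def)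
      also have "\<dots> = coeff ([:u 0, v 0:] * b r) k"
      proof -
        have "(\<Sum>j = 0..<m. if Suc j = k then coeff (b r) j * v 0 else 0)
            = (case k of 0 \<Rightarrow> 0 | Suc l \<Rightarrow> v 0 * coeff (b r) l)"
          using ik by (cases k) (auto simp: mult.commute)
        moreover have "(\<Sum>j = 0..<m. if j = k then coeff (b r) j * u 0 else 0) = u 0 * coeff (b r) k"
          using ik b_top[OF r] by (cases "k = m") (auto simp: mult.commute)
        ultimately show ?thesis
          by (cases k) (simp_all add: sum.distrib coeff_pCons)
      qed
      finally show ?thesis
        using ik Suc r unfolding CD by (simp add: B_def C_def row_Suc)
    qed
  qed (auto simp: B_def C_def D_def)
  then have "det B = det C * det D"
    by (simp add: det_mult[of _ "Suc m"] C_def D_def)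
  also have "det C = det (mat m m (\<lambda>(i, j). C $$ (Suc i, Suc j)))"
    by (rule det_first_col_unit) (auto simp: C_def)
  also have "mat m m (\<lambda>(i, j). C $$ (Suc i, Suc j))
      = mat m m (\<lambda>(i, k). coeff (lin_prod ?v ?u ({0..<m} - {i})) k)"
    by (rule eq_matI) (auto simp: C_def b_def)
  also have "det \<dots> = (\<Prod>(i, j) \<in> {(i, j). i < j \<and> j < m}. ?v i * ?u j - ?v j * ?u i)"
    by (rule Suc.IH)
  also have "det D = (\<Sum>k\<le>m. c k * (- u 0) ^ k * v 0 ^ (m - k))"
    unfolding D_def by (rule det_linear_sylvester)
  \<comment> \<open>Homogenised evaluation at the root of the factor of index 0.\<close>
  also have "\<dots> = (\<Prod>i\<in>{0..<m}. ?v i * (- u 0) + ?u i * v 0)"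
    unfolding c_def using sum_coeff_lin_prod_homogeneous[of "{0..<m}" ?v ?u "- u 0" "v 0"] by simp
  finally show ?case
    by (simp add: B_def prod_less_pairs_Suc[of _ m] mult.commute)
qed

text \<open>If \<open>Q\<close> lacks both factors 0 and \<open>Suc i\<close>, the terms of slope
  times slope cancel in the difference of the two row polynomials, leaving a constant times
  \<open>Q\<close>. The constants supply the pairs with 0, each with reversed sign, and the
  polynomials \<open>Q\<close> give the previous determinant.\<close>

lemma det_ones_lin_prod_delete:
  fixes v u :: "nat \<Rightarrow> 'a :: comm_ring_1"
  shows "det (mat (Suc m) (Suc m) (\<lambda>(i, k). if k = 0 then 1
      else v i * coeff (lin_prod v u ({0..<Suc m} - {i})) (k - 1)))
    = (- 1) ^ m * (\<Prod>(i, j) \<in> {(i, j). i < j \<and> j < Suc m}. v i * u j - v j * u i)"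
proof -
  let ?v = "v \<circ> Suc" and ?u = "u \<circ> Suc"
  let ?W = "\<lambda>i. lin_prod v u ({0..<Suc m} - {i})"
  have row: "v (Suc i) * coeff (?W (Suc i)) k - v 0 * coeff (?W 0) k
      = (v (Suc i) * u 0 - v 0 * u (Suc i)) * coeff (lin_prod ?v ?u ({0..<m} - {i})) k"
    if "i < m" for i k
  proof -
    define Q where "Q = lin_prod ?v ?u ({0..<m} - {i})"
    have "{0..<Suc m} - {Suc i} - {0} = Suc ` ({0..<m} - {i})"
      by (auto simp: image_set_diff image_Suc_atLeastLessThan)
    moreover have "{0..<Suc m} - {0} - {Suc i} = {0..<Suc m} - {Suc i} - {0}" by blast
    ultimately have Q: "lin_prod v u ({0..<Suc m} - {Suc i} - {0}) = Q"
      "lin_prod v u ({0..<Suc m} - {0} - {Suc i}) = Q"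
      by (simp_all add: Q_def lin_prod_reindex)
    have "?W (Suc i) = [:u 0, v 0:] * Q"
      by (subst lin_prod_remove[of _ 0]) (simp_all only: Q, auto)
    moreover have "?W 0 = [:u (Suc i), v (Suc i):] * Q"
      by (subst lin_prod_remove[of _ "Suc i"]) (use that in \<open>simp_all only: Q, auto\<close>)
    ultimately show ?thesis unfolding Q_def[symmetric]
      by (cases k) (simp_all add: coeff_pCons algebra_simps)
  qed
  have "det (mat (Suc m) (Suc m) (\<lambda>(i, k). if k = 0 then 1 else v i * coeff (?W i) (k - 1)))
      = det (mat m m (\<lambda>(i, k). v (Suc i) * coeff (?W (Suc i)) k - v 0 * coeff (?W 0) k))"
    by (rule det_subtract_first_row)
  also have "\<dots> = det (mat m m (\<lambda>(i, k). (v (Suc i) * u 0 - v 0 * u (Suc i))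
      * coeff (lin_prod ?v ?u ({0..<m} - {i})) k))"
    by (intro arg_cong[of _ _ det] eq_matI) (auto simp: row)
  also have "\<dots> = (\<Prod>i = 0..<m. v (Suc i) * u 0 - v 0 * u (Suc i))
      * (\<Prod>(i, j) \<in> {(i, j). i < j \<and> j < m}. ?v i * ?u j - ?v j * ?u i)"
    by (simp only: det_scale_rows det_coeff_lin_prod_delete)
  also have "(\<Prod>i = 0..<m. v (Suc i) * u 0 - v 0 * u (Suc i))
      = (- 1) ^ m * (\<Prod>i = 0..<m. v 0 * u (Suc i) - v (Suc i) * u 0)"
    using prod_uminus[of "\<lambda>i. v 0 * u (Suc i) - v (Suc i) * u 0" "{0..<m}"] by simp
  finally show ?thesis
    by (simp add: prod_less_pairs_Suc[of _ m] mult.assoc)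
qed

section \<open>The decomposition of \<open>C1 H\<close> and its determinant\<close>

text \<open>A minor has the same rank-two form, with the families reindexed by
  \<open>insert_index\<close>, which skips the deleted index.\<close>

lemma per_mat_delete_rank_two:
  fixes v u a b :: "nat \<Rightarrow> 'a :: {comm_semiring_1, semiring_char_0}"
  assumes "i < Suc m" "j < Suc m"
  shows "per (mat_delete (mat (Suc m) (Suc m) (\<lambda>(i, j). v i * a j + u i * b j)) i j)
    = (\<Sum>k\<le>m. fact k * fact (m - k) * coeff (lin_prod v u ({0..<Suc m} - {i})) k
        * coeff (lin_prod a b ({0..<Suc m} - {j})) k)"
proof -
  have del: "lin_prod (f \<circ> insert_index l) (g \<circ> insert_index l) {0..<m}
      = lin_prod f g ({0..<Suc m} - {l})" if "l < Suc m" for f g :: "nat \<Rightarrow> 'a" and l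
    using insert_index_image[OF that] by (simp add: lin_prod_reindex[OF insert_index_inj_on])
  have "mat_delete (mat (Suc m) (Suc m) (\<lambda>(i, j). v i * a j + u i * b j)) i j
      = mat m m (\<lambda>(i', j'). (v \<circ> insert_index i) i' * (a \<circ> insert_index j) j'
          + (u \<circ> insert_index i) i' * (b \<circ> insert_index j) j')"
    by (rule eq_matI) (auto simp: mat_delete_def insert_index_def)
  then show ?thesis
    by (simp only: per_rank_two del assms)
qed

text \<open>Once terms are collected by \<open>k\<close>, each inner \<open>k\<close> carries a
  quadratic form in \<open>w k\<close> and \<open>e k - w k\<close>, to be completed to a square. At
  \<open>k = 0\<close> and \<open>k = Suc m\<close> the boundary assumptions leave only
  \<open>e k * e' k\<close>.\<close>

lemma sum_fact_complete_square:
  fixes w w' e e' :: "nat \<Rightarrow> 'a :: field_char_0"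
  assumes "w 0 = 0" "w' 0 = 0" "w (Suc m) = e (Suc m)" "w' (Suc m) = e' (Suc m)"
  shows "(\<Sum>k\<le>m. fact k * fact (m - k) * (w (Suc k) * w' (Suc k) + (e k - w k) * (e' k - w' k)))
    = (\<Sum>k\<le>Suc m. fact k * fact (Suc m - k) * e k * e' k) / of_nat (Suc m)
      + (\<Sum>k = 1..m. of_nat (Suc m) * fact (k - 1) * fact (m - k)
          * (w k - of_nat k * e k / of_nat (Suc m)) * (w' k - of_nat k * e' k / of_nat (Suc m)))"
proof -
  let ?n = "of_nat (Suc m) :: 'a"
  have square: "fact (k - 1) * fact (Suc m - k) * (w k * w' k)
        + fact k * fact (m - k) * ((e k - w k) * (e' k - w' k))
      = fact k * fact (Suc m - k) * e k * e' k / ?n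
        + ?n * fact (k - 1) * fact (m - k)
          * (w k - of_nat k * e k / ?n) * (w' k - of_nat k * e' k / ?n)"
    if k: "k \<in> {1..m}" for k
  proof -
    obtain r where r: "k = Suc r" using k by (cases k) auto
    obtain s where s: "m = k + s" using k by (metis atLeastAtMost_iff le_Suc_ex)
    \<comment> \<open>With \<open>n = Suc m\<close>, \<open>K\<close> is \<open>k\<close> and
      \<open>S\<close> is \<open>n - k\<close>. These are the weights left after dividing by
      \<open>fact (k - 1) * fact (m - k)\<close>, and they add up to \<open>n\<close>.\<close>
    define K where "K = (of_nat k :: 'a)"
    define S where "S = (of_nat (Suc s) :: 'a)"
    have n: "?n = K + S" by (simp add: K_def S_def s)
    have nz: "K + S \<noteq> 0" unfolding n[symmetric] by (rule of_nat_neq_0)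
    have f: "fact k = K * fact r" "fact (Suc m - k) = S * fact s" "fact (k - 1) = (fact r :: 'a)"
      "fact (m - k) = (fact s :: 'a)"
      by (simp_all add: K_def S_def r s)
    have "S * (w k * w' k) + K * ((e k - w k) * (e' k - w' k))
        = K * S * e k * e' k / (K + S)
          + (K + S) * (w k - K * e k / (K + S)) * (w' k - K * e' k / (K + S))"
    proof -
      \<comment> \<open>Expressing \<open>e k\<close> and \<open>e' k\<close> through their
        quotients by \<open>K + S\<close> makes the identity polynomial.\<close>
      define x y where "x = e k / (K + S)" and "y = e' k / (K + S)"
      have "e k = (K + S) * x" "e' k = (K + S) * y" using nz by (simp_all add: x_def y_def)
      moreover have "K * S * ((K + S) * x) * ((K + S) * y) / (K + S) = K * S * (K + S) * x * y"
        using nz by simp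
      moreover have "K * ((K + S) * z) / (K + S) = K * z" for z
        using nz by simp
      ultimately show ?thesis by (simp only:) (simp add: algebra_simps)
    qed
    from arg_cong[OF this[folded n], of "\<lambda>x. fact r * fact s * x"] show ?thesis
      unfolding f K_def[symmetric]
      by (simp only: distrib_left mult_ac times_divide_eq_right times_divide_eq_left)
  qed
  have "(\<Sum>k\<le>m. fact k * fact (m - k) * (w (Suc k) * w' (Suc k) + (e k - w k) * (e' k - w' k)))
      = (\<Sum>k\<le>m. fact k * fact (m - k) * (w (Suc k) * w' (Suc k)))
        + (\<Sum>k\<le>m. fact k * fact (m - k) * ((e k - w k) * (e' k - w' k)))"
    by (simp add: distrib_left sum.distrib)
  \<comment> \<open>Shifting the index makes \<open>w k\<close> and \<open>e k - w k\<close> meet at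
    the same \<open>k\<close>.\<close>
  also have "(\<Sum>k\<le>m. fact k * fact (m - k) * (w (Suc k) * w' (Suc k)))
      = (\<Sum>k = 1..Suc m. fact (k - 1) * fact (Suc m - k) * (w k * w' k))"
    by (simp only: atMost_atLeast0 One_nat_def sum.shift_bounds_cl_Suc_ivl) simp
  also have "\<dots> = (\<Sum>k = 1..m. fact (k - 1) * fact (Suc m - k) * (w k * w' k))
      + fact m * (e (Suc m) * e' (Suc m))"
    using assms by simp
  also have "(\<Sum>k\<le>m. fact k * fact (m - k) * ((e k - w k) * (e' k - w' k)))
      = fact m * (e 0 * e' 0) + (\<Sum>k = 1..m. fact k * fact (m - k) * ((e k - w k) * (e' k - w' k)))"
    using assms by (simp add: atMost_atLeast0 sum.atLeast_Suc_atMost)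
  finally have lhs: "(\<Sum>k\<le>m. fact k * fact (m - k)
        * (w (Suc k) * w' (Suc k) + (e k - w k) * (e' k - w' k)))
      = fact m * (e 0 * e' 0) + fact m * (e (Suc m) * e' (Suc m))
        + (\<Sum>k = 1..m. fact (k - 1) * fact (Suc m - k) * (w k * w' k)
            + fact k * fact (m - k) * ((e k - w k) * (e' k - w' k)))"
    by (simp add: sum.distrib)
  have fact_n: "fact (Suc m) * x / ?n = fact m * x" for x
    by (simp del: of_nat_Suc)
  have "(\<Sum>k\<le>Suc m. fact k * fact (Suc m - k) * e k * e' k) / ?n
      = (fact (Suc m) * (e 0 * e' 0) + (\<Sum>k = 1..m. fact k * fact (Suc m - k) * e k * e' k)
        + fact (Suc m) * (e (Suc m) * e' (Suc m))) / ?n"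
    by (simp add: atMost_atLeast0 sum.atLeast_Suc_atMost[of 0] mult.assoc del: fact_Suc)
  also have "\<dots> = fact m * (e 0 * e' 0)
      + (\<Sum>k = 1..m. fact k * fact (Suc m - k) * e k * e' k / ?n)
      + fact m * (e (Suc m) * e' (Suc m))"
    by (simp only: add_divide_distrib fact_n sum_divide_distrib)
  finally have rhs: "(\<Sum>k\<le>Suc m. fact k * fact (Suc m - k) * e k * e' k) / ?n = \<dots>" .
  have "(\<Sum>k = 1..m. fact (k - 1) * fact (Suc m - k) * (w k * w' k)
        + fact k * fact (m - k) * ((e k - w k) * (e' k - w' k)))
      = (\<Sum>k = 1..m. fact k * fact (Suc m - k) * e k * e' k / ?n)
        + (\<Sum>k = 1..m. ?n * fact (k - 1) * fact (m - k)
          * (w k - of_nat k * e k / ?n) * (w' k - of_nat k * e' k / ?n))"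
    unfolding sum.distrib[symmetric] by (rule sum.cong[OF refl square])
  then show ?thesis unfolding lhs rhs by (simp only: add_ac)
qed

lemma coeff_lin_prod_split:
  fixes v u :: "'b \<Rightarrow> 'a :: comm_ring_1"
  assumes "finite A" "i \<in> A"
  shows "u i * coeff (lin_prod v u (A - {i})) k = coeff (lin_prod v u A) k
    - (if k = 0 then 0 else v i * coeff (lin_prod v u (A - {i})) (k - 1))"
  unfolding lin_prod_remove[OF assms] by (cases k) (simp_all add: coeff_pCons)

text \<open>\<open>w m v u i k\<close> is the \<open>i\<close>-th entry of the centred vector
  \<open>z\<^sub>k\<close>. Multiplying an entry of \<open>H\<close> into its permanental minor
  pairs \<open>v i\<close> with a raised degree and \<open>u i\<close> with an unchanged one, which
  is the sum whose square was completed.\<close>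

lemma C1_rank_two_decomposition:
  fixes v u a b :: "nat \<Rightarrow> 'a :: field_char_0"
  defines "w \<equiv> \<lambda>m v u i k. v i * coeff (lin_prod v u ({0..<Suc m} - {i})) (k - 1)
    - of_nat k * coeff (lin_prod v u {0..<Suc m}) k / of_nat (Suc m)"
  assumes H: "H = mat (Suc m) (Suc m) (\<lambda>(i, j). v i * a j + u i * b j)"
    and ij: "i < Suc m" "j < Suc m"
  shows "C1 H $$ (i, j) = per H / of_nat (Suc m)
    + (\<Sum>k = 1..m. of_nat (Suc m) * fact (k - 1) * fact (m - k) * w m v u i k * w m a b j k)"
proof -
  let ?N = "{0..<Suc m}"
  define p q where "p = coeff (lin_prod v u (?N - {i}))" and "q = coeff (lin_prod a b (?N - {j}))"
  define e e' where "e = coeff (lin_prod v u ?N)" and "e' = coeff (lin_prod a b ?N)"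
  \<comment> \<open>The coefficient of the linear term of factor \<open>i\<close> times the
    remaining product. The value at 0 is set explicitly, since \<open>k - 1\<close> would truncate
    to 0 there.\<close>
  define x where "x k = (if k = 0 then 0 else v i * p (k - 1))" for k
  define y where "y k = (if k = 0 then 0 else a j * q (k - 1))" for k
  have split: "u i * p k = e k - x k" "b j * q k = e' k - y k" for k
    using coeff_lin_prod_split[of ?N i u v k] coeff_lin_prod_split[of ?N j b a k] ij
    by (auto simp: p_def q_def e_def e'_def x_def y_def)
  \<comment> \<open>Only \<open>m\<close> factors remain, so in degree \<open>Suc m\<close> the
    constant term of factor \<open>i\<close> contributes nothing.\<close>
  have "p (Suc m) = 0" "q (Suc m) = 0"
    unfolding p_def q_def using ij by (auto intro!: coeff_lin_prod_eq_0)
  then have top: "x (Suc m) = e (Suc m)" "y (Suc m) = e' (Suc m)"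
    using split[of "Suc m"] by simp_all
  have "C1 H $$ (i, j)
      = (v i * a j + u i * b j) * (\<Sum>k\<le>m. fact k * fact (m - k) * p k * q k)"
    using ij per_mat_delete_rank_two[OF ij, of v a u b] by (simp add: C1_def H p_def q_def)
  also have "\<dots> = (\<Sum>k\<le>m. fact k * fact (m - k)
      * (v i * p k * (a j * q k) + u i * p k * (b j * q k)))"
    unfolding sum_distrib_left by (intro sum.cong) (auto simp: algebra_simps)
  also have "\<dots> = (\<Sum>k\<le>m. fact k * fact (m - k)
      * (x (Suc k) * y (Suc k) + (e k - x k) * (e' k - y k)))"
    unfolding split by (simp add: x_def y_def)
  also have "\<dots> = per H / of_nat (Suc m) + (\<Sum>k = 1..m. of_nat (Suc m) * fact (k - 1) * fact (m - k)
      * (x k - of_nat k * e k / of_nat (Suc m)) * (y k - of_nat k * e' k / of_nat (Suc m)))"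
    unfolding H per_rank_two e_def[symmetric] e'_def[symmetric]
    by (rule sum_fact_complete_square) (use top in \<open>auto simp: x_def y_def\<close>)
  also have "(\<Sum>k = 1..m. of_nat (Suc m) * fact (k - 1) * fact (m - k)
      * (x k - of_nat k * e k / of_nat (Suc m)) * (y k - of_nat k * e' k / of_nat (Suc m)))
    = (\<Sum>k = 1..m. of_nat (Suc m) * fact (k - 1) * fact (m - k) * w m v u i k * w m a b j k)"
    by (intro sum.cong refl) (simp add: x_def y_def w_def p_def q_def e_def e'_def)
  finally show ?thesis .
qed

text \<open>The decomposition has exactly as many rank-one terms as the matrix has rows, so the
  determinant factors. The sign \<open>(- 1) ^ m\<close> arises once from each pair of families and
  cancels.\<close>

lemma det_C1_rank_two:
  fixes v u a b :: "nat \<Rightarrow> 'a :: field_char_0"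
  assumes H: "H = mat (Suc m) (Suc m) (\<lambda>(i, j). v i * a j + u i * b j)"
  shows "det (C1 H) = per H / of_nat (Suc m)
    * (\<Prod>k = 1..m. of_nat (Suc m) * fact (k - 1) * fact (m - k))
    * (\<Prod>(i, j) \<in> {(i, j). i < j \<and> j < Suc m}. v i * u j - v j * u i)
    * (\<Prod>(i, j) \<in> {(i, j). i < j \<and> j < Suc m}. a i * b j - a j * b i)"
proof -
  define W where "W v u i k = v i * coeff (lin_prod v u ({0..<Suc m} - {i})) (k - 1)"
    for v u :: "nat \<Rightarrow> 'a" and i k
  define c where "c v u k = of_nat k * coeff (lin_prod v u {0..<Suc m}) k / of_nat (Suc m)"
    for v u :: "nat \<Rightarrow> 'a" and k
  \<comment> \<open>Column 0 is the vector of ones, weighted by \<open>d 0\<close>; the later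
    columns are the centred vectors.\<close>
  define M where "M v u i k = (if k = 0 then 1 else W v u i k - c v u k)"
    for v u :: "nat \<Rightarrow> 'a" and i k
  define d where "d k = (if k = 0 then per H / of_nat (Suc m)
    else of_nat (Suc m) * fact (k - 1) * fact (m - k))" for k
  have det_M: "det (mat (Suc m) (Suc m) (\<lambda>(i, k). M v u i k))
      = (- 1) ^ m * (\<Prod>(i, j) \<in> {(i, j). i < j \<and> j < Suc m}. v i * u j - v j * u i)"
    for v u :: "nat \<Rightarrow> 'a"
    unfolding M_def det_subtract_multiples_of_first_col
    unfolding W_def by (rule det_ones_lin_prod_delete)
  have range: "{0..<Suc m} = insert 0 {1..m}" by auto
  have "C1 H = mat (Suc m) (Suc m) (\<lambda>(i, j). \<Sum>k = 0..<Suc m. d k * M v u i k * M a b j k)"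
  proof (rule eq_matI, goal_cases)
    case (1 i j)
    then have ij: "i < Suc m" "j < Suc m" by auto
    have "C1 H $$ (i, j) = d 0 * M v u i 0 * M a b j 0 + (\<Sum>k = 1..m. d k * M v u i k * M a b j k)"
      unfolding C1_rank_two_decomposition[OF H ij] by (simp add: d_def M_def W_def c_def)
    then show ?case using ij by (simp add: range del: sum.op_ivl_Suc)
  qed (auto simp: C1_def H)
  then have "det (C1 H) = (\<Prod>k = 0..<Suc m. d k)
      * ((- 1) ^ m * (\<Prod>(i, j) \<in> {(i, j). i < j \<and> j < Suc m}. v i * u j - v j * u i))
      * ((- 1) ^ m * (\<Prod>(i, j) \<in> {(i, j). i < j \<and> j < Suc m}. a i * b j - a j * b i))"
    by (simp only: det_mat_sum_rank_one det_M)
  also have "(\<Prod>k = 0..<Suc m. d k) = per H / of_nat (Suc m)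
      * (\<Prod>k = 1..m. of_nat (Suc m) * fact (k - 1) * fact (m - k))"
    unfolding range by (simp add: d_def)
  also have "P * ((- 1) ^ m * Q) * ((- 1) ^ m * R) = P * Q * R" for P Q R :: 'a
    by (simp add: mult_ac flip: power_mult_distrib)
  finally show ?thesis .
qed

theorem theorem3p1:
  fixes n :: nat and v u :: "complex vec" and H :: "complex mat"
  assumes "n \<ge> 2"
    and "v \<in> carrier_vec n" and "u \<in> carrier_vec n"
    and "H = col_mat v * mat_adjoint (col_mat v) + col_mat u * mat_adjoint (col_mat u)"
  shows "det (C1 H) =
    per H / of_nat n
    * (\<Prod>k = 1..n - 1. of_nat n * fact (k - 1) * fact (n - 1 - k))
    * (\<Prod>(i, j) \<in> {(i, j). i < j \<and> j < n}.
         complex_of_real ((cmod (v $ i * u $ j - v $ j * u $ i))\<^sup>2))"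
proof -
  obtain m where m: "n = Suc m" using assms(1) by (cases n) auto
  have "H = mat (Suc m) (Suc m) (\<lambda>(i, j). v $ i * cnj (v $ j) + u $ i * cnj (u $ j))"
    unfolding assms(4) col_mat_times_adjoint[OF assms(2)] col_mat_times_adjoint[OF assms(3)]
    by (rule eq_matI) (auto simp: m)
  \<comment> \<open>Here \<open>a\<close> and \<open>b\<close> are the conjugates of
    \<open>v\<close> and \<open>u\<close>, so the two products over pairs are conjugate and combine
    to squared moduli.\<close>
  from det_C1_rank_two[OF this] show ?thesis
    by (simp add: m complex_norm_square prod.distrib case_prod_unfold mult.assoc
        del: of_nat_Suc of_real_power)
qed

end
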